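(* Let $(\mathcal T,d)$ be a duality triangulation, with finitely many simplices, of a connected surface, such that $d_{ij}>0$ for all directed edges $(i,j)\in\mathcal T_1^+$. Then the Laplacian matrix $L$ is negative semidefinite with nullspace spanned by the constant vectors.
   Context: $\mathcal T_k$ denotes the set of $k$-simplices of a triangulation $\mathcal T$ and $\mathcal T_1^+$ the set of directed edges. A duality triangulation $(\mathcal T,d)$ of a surface (2-dimensional manifold) is a function $d:\mathcal T_1^+\to\mathbb R$ with $d_{ij}^2+d_{jk}^2+d_{ki}^2=d_{ji}^2+d_{ik}^2+d_{kj}^2$ for each $\{i,j,k\}\in\mathcal T_2$ and such that $\ell_{ij}=d_{ij}+d_{ji}>0$ are the edge lengths of a nondegenerate Euclidean triangle for each triangle of $\mathcal T$. The center $C(\{i,j\})$ of an edge is the point of the line through the edge at signed distance $d_{ij}$ from $i$ in the direction of $j$; the three perpendiculars to the edges of a triangle through the edge centers meet in one point, the center $C(\{i,j,k\})$. For an edge $\{i,j\}$ common to the triangles $\{i,j,k\}$ and $\{i,j,l\}$, $|\bigstar\{i,j\}|=h_k+h_l$, where $h_k$ is the distance from $C(\{i,j,k\})$ to $C(\{i,j\})$, with positive sign if $C(\{i,j,k\})$ is on the same side of the line through $\{i,j\}$ as the triangle $\{i,j,k\}$ and negative sign if on the other side, and $h_l$ is defined likewise. We write $|\{i,j\}|=\ell_{ij}$. The matrix $L$, indexed by the vertices $\mathcal T_0$, has $L_{ij}=\frac{|\bigstar\{i,j\}|}{|\{i,j\}|}$ for $\{i,j\}\in\mathcal T_1$, $L_{ij}=0$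 for $i\ne j$ with $\{i,j\}\notin\mathcal T_1$, and $L_{ii}=-\sum_{j:\{i,j\}\in\mathcal T_1}\frac{|\bigstar\{i,j\}|}{|\{i,j\}|}$. *)

theory Defs
  imports "HOL-Analysis.Analysis"
begin

text \<open>
  Simplices are represented by their (nonempty) vertex sets. The vertices of a complex exhaust the
  finite index type, so that vectors and matrices indexed by the vertices have types
  \<open>real^'v\<close> and \<open>real^'v^'v\<close>.
\<close>

definition simplicial_complex_on_type :: "'v set set \<Rightarrow> bool" where
  "simplicial_complex_on_type K \<longleftrightarrow>
     (\<forall>v. {v} \<in> K) \<and> {} \<notin> K \<and>
     (\<forall>\<sigma>\<in>K. \<forall>\<tau>. \<tau> \<noteq> {} \<and> \<tau> \<subseteq> \<sigma> \<longrightarrow> \<tau> \<in> K)"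

definition simplices :: "nat \<Rightarrow> 'v set set \<Rightarrow> 'v set set" where
  "simplices k K = {\<sigma> \<in> K. card \<sigma> = k + 1}"

definition directed_edges :: "'v set set \<Rightarrow> ('v \<times> 'v) set" where
  "directed_edges K = {(i, j). {i, j} \<in> simplices 1 K}"

definition realization :: "('v::finite) set set \<Rightarrow> (real^'v) set" where
  "realization K = (\<Union>\<sigma>\<in>K. convex hull ((\<lambda>v. axis v 1) ` \<sigma>))"

text \<open>
  Manifolds are without boundary. As subspaces of Euclidean space, realizations are automatically
  Hausdorff and second countable.
\<close>

definition surface :: "('a::euclidean_space) set \<Rightarrow> bool" where
  "surface S \<longleftrightarrow>
     (\<forall>x\<in>S. \<exists>U. openin (top_of_set S) U \<and> x \<in> U \<and>
        (\<exists>W :: (real^2) set. open W \<and> U homeomorphic W))"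

definition edge_length :: "('v \<Rightarrow> 'v \<Rightarrow> real) \<Rightarrow> 'v \<Rightarrow> 'v \<Rightarrow> real" where
  "edge_length d i j = d i j + d j i"

text \<open>A placement of the triangle \<open>t\<close> in the Euclidean plane with the prescribed edge lengths.\<close>

definition euclidean_layout ::
    "('v \<Rightarrow> 'v \<Rightarrow> real) \<Rightarrow> 'v set \<Rightarrow> ('v \<Rightarrow> real^2) \<Rightarrow> bool" where
  "euclidean_layout d t p \<longleftrightarrow>
     (\<forall>i\<in>t. \<forall>j\<in>t. i \<noteq> j \<longrightarrow> dist (p i) (p j) = edge_length d i j) \<and>
     \<not> collinear (p ` t)"

definition duality_triangulation ::
    "('v::finite) set set \<Rightarrow> ('v \<Rightarrow> 'v \<Rightarrow> real) \<Rightarrow> bool" where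
  "duality_triangulation K d \<longleftrightarrow>
     simplicial_complex_on_type K \<and> surface (realization K) \<and>
     (\<forall>i j k. {i, j, k} \<in> simplices 2 K \<longrightarrow>
        (d i j)\<^sup>2 + (d j k)\<^sup>2 + (d k i)\<^sup>2 = (d j i)\<^sup>2 + (d i k)\<^sup>2 + (d k j)\<^sup>2) \<and>
     (\<forall>(i, j) \<in> directed_edges K. edge_length d i j > 0) \<and>
     (\<forall>t \<in> simplices 2 K. \<exists>p. euclidean_layout d t p)"

definition layout :: "('v \<Rightarrow> 'v \<Rightarrow> real) \<Rightarrow> 'v set \<Rightarrow> 'v \<Rightarrow> real^2" where
  "layout d t = (SOME p. euclidean_layout d t p)"

definition edge_center ::
    "('v \<Rightarrow> 'v \<Rightarrow> real) \<Rightarrow> ('v \<Rightarrow> real^2) \<Rightarrow> 'v \<Rightarrow> 'v \<Rightarrow> real^2" where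
  "edge_center d p i j = p i + (d i j / dist (p i) (p j)) *\<^sub>R (p j - p i)"

text \<open>The common point of the three perpendiculars to the edges through the edge centers.\<close>

definition triangle_center ::
    "('v \<Rightarrow> 'v \<Rightarrow> real) \<Rightarrow> ('v \<Rightarrow> real^2) \<Rightarrow> 'v set \<Rightarrow> real^2" where
  "triangle_center d p t =
     (THE c. \<forall>i\<in>t. \<forall>j\<in>t. i \<noteq> j \<longrightarrow> (c - edge_center d p i j) \<bullet> (p j - p i) = 0)"

text \<open>
  The signed distance from the center of \<open>{i, j, k}\<close> to the center of its edge \<open>{i, j}\<close>. It does not
  depend on the chosen layout, since layouts are unique up to isometries of the plane. If the
  triangle center lies on the line through the edge, it is the edge center, so the sign is
  immaterial.
\<close>

definition height :: "('v \<Rightarrow> 'v \<Rightarrow> real) \<Rightarrow> 'v \<Rightarrow> 'v \<Rightarrow> 'v \<Rightarrow> real" where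
  "height d i j k =
     (let p = layout d {i, j, k};
          c = triangle_center d p {i, j, k};
          m = edge_center d p i j
      in if closed_segment c (p k) \<inter> affine hull {p i, p j} = {} then dist c m else - dist c m)"

text \<open>On a surface without boundary every edge lies in exactly two triangles, so the sum has two
  terms.\<close>

definition dual_length ::
    "('v::finite) set set \<Rightarrow> ('v \<Rightarrow> 'v \<Rightarrow> real) \<Rightarrow> 'v \<Rightarrow> 'v \<Rightarrow> real" where
  "dual_length K d i j = (\<Sum>k | {i, j, k} \<in> simplices 2 K. height d i j k)"

definition laplacian ::
    "('v::finite) set set \<Rightarrow> ('v \<Rightarrow> 'v \<Rightarrow> real) \<Rightarrow> real^'v^'v" where
  "laplacian K d = (\<chi> i j.
     if i = j then - (\<Sum>k | {i, k} \<in> simplices 1 K. dual_length K d i k / edge_length d i k)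
     else if {i, j} \<in> simplices 1 K then dual_length K d i j / edge_length d i j
     else 0)"

definition negative_semidefinite :: "real^'n^'n \<Rightarrow> bool" where
  "negative_semidefinite A \<longleftrightarrow> transpose A = A \<and> (\<forall>x. x \<bullet> (A *v x) \<le> 0)"

end

theory Submission
  imports Defs
begin

text \<open>
  The quadratic form of \<open>- L\<close> is the sum over the triangles of the forms
  \<open>a (x - y)\<^sup>2 + b (y - z)\<^sup>2 + c (z - x)\<^sup>2\<close> in the three vertex values,
  where \<open>a\<close>, \<open>b\<close>, \<open>c\<close> are the signed heights of the triangle center divided by the edge
  lengths. Up to a positive factor \<open>a b + b c + c a\<close> is minus the power of the center with respect
  to the circumcircle. It equals, again up to a positive factor, \<open>d\<^sub>1\<^sub>2 d\<^sub>3\<^sub>1 d\<^sub>2\<^sub>3 + d\<^sub>2\<^sub>1 d\<^sub>1\<^sub>3 d\<^sub>3\<^sub>2\<close>, so it is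
  positive. Hence each form is definite modulo constants, and it is positive because its values at
  the two coordinate functions add up to twice the area of the triangle.

  A vector in the kernel is therefore constant on every triangle. By invariance of dimension every
  edge of a surface lies in a triangle, so the piecewise linear extension of the vector is constant
  on every simplex; it has finite range and so is constant on the connected realization.
\<close>

section \<open>Definiteness of weighted sums of squared differences\<close>

text \<open>Completing the square in \<open>v\<close>, whose coefficient is \<open>a + b\<close>;
  the remainder carries the discriminant. The vectors \<open>u\<close> and \<open>v\<close> stand
  for two vertices relative to the third.\<close>

lemma weighted_squares_identity:
  fixes u v :: "'a::real_inner"
  shows "(a + b) * (a * (norm (u - v))\<^sup>2 + b * (norm v)\<^sup>2 + c * (norm u)\<^sup>2)
    = (norm ((a + b) *\<^sub>R v - a *\<^sub>R u))\<^sup>2 + (a * b + b * c + c * a) * (norm u)\<^sup>2"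
  unfolding power2_norm_eq_inner
  by (simp add: inner_diff_left inner_diff_right inner_commute algebra_simps power2_eq_square)

text \<open>A positive discriminant makes the form definite modulo constants, with the sign of
  \<open>a + b\<close>. One positive value settles that sign; it is taken at points of an inner
  product space so that both coordinates of a plane triangle enter at once.\<close>

lemma weighted_squares_definite:
  fixes p q r :: "'a::real_inner" and x y z a b c :: real
  assumes disc: "a * b + b * c + c * a > 0"
    and pos: "a * (dist p q)\<^sup>2 + b * (dist q r)\<^sup>2 + c * (dist r p)\<^sup>2 > 0"
  shows "a * (x - y)\<^sup>2 + b * (y - z)\<^sup>2 + c * (z - x)\<^sup>2 \<ge> 0"
    and "a * (x - y)\<^sup>2 + b * (y - z)\<^sup>2 + c * (z - x)\<^sup>2 = 0 \<Longrightarrow> x = y \<and> y = z"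
proof -
  have eqp: "(a + b) * (a * (dist p q)\<^sup>2 + b * (dist q r)\<^sup>2 + c * (dist r p)\<^sup>2)
     = (norm ((a + b) *\<^sub>R (q - r) - a *\<^sub>R (p - r)))\<^sup>2
       + (a * b + b * c + c * a) * (norm (p - r))\<^sup>2"
    using weighted_squares_identity[of a b "p - r" "q - r" c]
    by (simp add: dist_norm norm_minus_commute[of r p])
  have "a + b \<noteq> 0"
  proof
    assume "a + b = 0"
    then have "b = - a" by simp
    \<comment> \<open>The discriminant would equal \<open>- a * a\<close>.\<close>
    with disc show False by (simp add: algebra_simps)
  qed
  moreover have "(a + b) * (a * (dist p q)\<^sup>2 + b * (dist q r)\<^sup>2 + c * (dist r p)\<^sup>2) \<ge> 0"
    unfolding eqp by (intro add_nonneg_nonneg mult_nonneg_nonneg[OF less_imp_le[OF disc]] zero_le_power2)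
  ultimately have ab: "a + b > 0"
    using pos by (simp add: zero_le_mult_iff)
  have eqx: "(a + b) * (a * (x - y)\<^sup>2 + b * (y - z)\<^sup>2 + c * (z - x)\<^sup>2)
     = ((a + b) * (y - z) - a * (x - z))\<^sup>2 + (a * b + b * c + c * a) * (x - z)\<^sup>2"
    by (simp add: algebra_simps power2_eq_square)
  have nn: "(a + b) * (a * (x - y)\<^sup>2 + b * (y - z)\<^sup>2 + c * (z - x)\<^sup>2) \<ge> 0"
    unfolding eqx by (intro add_nonneg_nonneg mult_nonneg_nonneg[OF less_imp_le[OF disc]] zero_le_power2)
  then show "a * (x - y)\<^sup>2 + b * (y - z)\<^sup>2 + c * (z - x)\<^sup>2 \<ge> 0"
    using ab by (simp add: zero_le_mult_iff)
  assume "a * (x - y)\<^sup>2 + b * (y - z)\<^sup>2 + c * (z - x)\<^sup>2 = 0"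
  then have z: "((a + b) * (y - z) - a * (x - z))\<^sup>2 + (a * b + b * c + c * a) * (x - z)\<^sup>2 = 0"
    using eqx by simp
  have "(a * b + b * c + c * a) * (x - z)\<^sup>2 \<ge> 0" using disc by simp
  then have "(a * b + b * c + c * a) * (x - z)\<^sup>2 = 0" "((a + b) * (y - z) - a * (x - z))\<^sup>2 = 0"
    using z by (smt (verit) zero_le_power2)+
  then have "x = z" "(a + b) * (y - z) = a * (x - z)" using disc by auto
  then show "x = y \<and> y = z" using ab by simp
qed

section \<open>Oriented area in the plane\<close>

text \<open>The determinant: twice the signed area of the triangle with vertices 0,
  \<open>a\<close>, \<open>b\<close>.\<close>

definition cross2 :: "real^2 \<Rightarrow> real^2 \<Rightarrow> real" where
  "cross2 a b = a $ 1 * b $ 2 - a $ 2 * b $ 1"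

lemma inner2: "(a::real^2) \<bullet> b = a $ 1 * b $ 1 + a $ 2 * b $ 2"
  by (simp add: inner_vec_def sum_2)

lemma power2_dist2: "(dist (a::real^2) b)\<^sup>2 = (a $ 1 - b $ 1)\<^sup>2 + (a $ 2 - b $ 2)\<^sup>2"
  unfolding dist_norm power2_norm_eq_inner inner2 by (simp add: power2_eq_square)

lemma cross2_inner_lagrange: "(cross2 a b)\<^sup>2 + (a \<bullet> b)\<^sup>2 = (norm a)\<^sup>2 * (norm b)\<^sup>2"
  unfolding power2_norm_eq_inner inner2 cross2_def by (simp add: algebra_simps power2_eq_square)

text \<open>The equality case of Cauchy-Schwarz, squared so that Lagrange's identity
  applies.\<close>

lemma collinear_iff_cross2:
  fixes p q r :: "real^2"
  shows "collinear {p, q, r} \<longleftrightarrow> cross2 (q - p) (r - p) = 0"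
proof -
  have "collinear {p, q, r} \<longleftrightarrow> collinear {0, q - p, r - p}"
    using collinear_3[of q p r] by (simp add: insert_commute collinear_def NO_MATCH_def)
  also have "\<dots> \<longleftrightarrow> \<bar>(q - p) \<bullet> (r - p)\<bar> = \<bar>norm (q - p) * norm (r - p)\<bar>"
    by (simp add: norm_cauchy_schwarz_equal)
  also have "\<dots> \<longleftrightarrow> ((q - p) \<bullet> (r - p))\<^sup>2 = (norm (q - p))\<^sup>2 * (norm (r - p))\<^sup>2"
    unfolding abs_eq_iff power_mult_distrib[symmetric] power2_eq_iff by (rule refl)
  also have "\<dots> \<longleftrightarrow> cross2 (q - p) (r - p) = 0"
    using cross2_inner_lagrange[of "q - p" "r - p"] by auto
  finally show ?thesis .
qed

text \<open>The coefficients are the signed heights of \<open>m\<close> divided by the edge lengths;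
  \<open>sgn D\<close> removes the dependence on orientation. The six inner product hypotheses say
  that \<open>m\<close> projects into the interior of every edge.\<close>

lemma weighted_triangle_form_definite:
  fixes p q r m :: "real^2" and x y z :: real
  defines "D \<equiv> cross2 (q - p) (r - p)"
  defines "a \<equiv> sgn D * cross2 (q - p) (m - p) / (dist p q)\<^sup>2"
    and "b \<equiv> sgn D * cross2 (r - q) (m - q) / (dist q r)\<^sup>2"
    and "c \<equiv> sgn D * cross2 (p - r) (m - r) / (dist r p)\<^sup>2"
  assumes D: "D \<noteq> 0"
    and pq: "(m - p) \<bullet> (q - p) > 0" and qp: "(m - q) \<bullet> (p - q) > 0"
    and qr: "(m - q) \<bullet> (r - q) > 0" and rq: "(m - r) \<bullet> (q - r) > 0"
    and rp: "(m - r) \<bullet> (p - r) > 0" and pr: "(m - p) \<bullet> (r - p) > 0"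
  shows "a * (x - y)\<^sup>2 + b * (y - z)\<^sup>2 + c * (z - x)\<^sup>2 \<ge> 0"
    and "a * (x - y)\<^sup>2 + b * (y - z)\<^sup>2 + c * (z - x)\<^sup>2 = 0 \<Longrightarrow> x = y \<and> y = z"
proof -
  define A where "A = (dist p q)\<^sup>2"
  define B where "B = (dist q r)\<^sup>2"
  define C where "C = (dist r p)\<^sup>2"
  have "p \<noteq> q" "q \<noteq> r" "r \<noteq> p" using pq qr rp by auto
  then have pos: "A > 0" "B > 0" "C > 0" by (simp_all add: A_def B_def C_def)
  define S where "S = cross2 (q - p) (m - p)"
  define T where "T = cross2 (r - q) (m - q)"
  define U where "U = cross2 (p - r) (m - r)"
  \<comment> \<open>The triangles spanned by \<open>m\<close> and the edges have signed areas adding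
    up to that of the whole triangle. Hence the form has value \<open>sgn D * D\<close>, which is
    the absolute value of \<open>D\<close>, at the vertices.\<close>
  have "S + T + U = D"
    unfolding S_def T_def U_def D_def cross2_def by (simp add: algebra_simps)
  moreover have abc: "a = sgn D * S / A" "b = sgn D * T / B" "c = sgn D * U / C"
    by (simp_all add: a_def b_def c_def S_def T_def U_def A_def B_def C_def)
  ultimately have "a * A + b * B + c * C = sgn D * D"
    using pos by (simp add: distrib_left[symmetric])
  then have sum: "a * A + b * B + c * C > 0"
    using D by (simp add: sgn_mult_self_eq abs_sgn[symmetric] mult.commute)
  \<comment> \<open>The left side is the discriminant cleared of the denominators
    \<open>A * B * C\<close>. Each product on the right takes one inner product from each edge, one
    product for each sense of rotation.\<close>
  have "S * T * C + T * U * A + U * S * B =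
      ((m - p) \<bullet> (q - p)) * ((m - r) \<bullet> (p - r)) * ((m - q) \<bullet> (r - q))
    + ((m - q) \<bullet> (p - q)) * ((m - p) \<bullet> (r - p)) * ((m - r) \<bullet> (q - r))"
    unfolding S_def T_def U_def A_def B_def C_def cross2_def power2_dist2 inner2 vector_minus_component
    by algebra
  also have "\<dots> > 0" using assms by (intro add_pos_pos mult_pos_pos) auto
  finally have "(S * T * C + T * U * A + U * S * B) / (A * B * C) > 0" using pos by simp
  also have "(S * T * C + T * U * A + U * S * B) / (A * B * C)
      = (sgn D)\<^sup>2 * (S * T * C + T * U * A + U * S * B) / (A * B * C)"
    using D by (simp add: sgn_if)
  also have "\<dots> = a * b + b * c + c * a"
    using pos unfolding abc by (simp add: field_simps power2_eq_square)
  finally have disc: "a * b + b * c + c * a > 0" .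
  note * = weighted_squares_definite[OF disc sum[unfolded A_def B_def C_def], of x y z]
  show "a * (x - y)\<^sup>2 + b * (y - z)\<^sup>2 + c * (z - x)\<^sup>2 \<ge> 0" by (rule *(1))
  show "a * (x - y)\<^sup>2 + b * (y - z)\<^sup>2 + c * (z - x)\<^sup>2 = 0 \<Longrightarrow> x = y \<and> y = z" by (rule *(2))
qed

section \<open>Topology of the realization\<close>

text \<open>The coordinates of \<open>y\<close> are its barycentric coordinates: the conditions
  define a convex set containing the vertices of the simplex.\<close>

lemma convex_hull_axesD:
  fixes \<sigma> :: "'v::finite set"
  assumes "y \<in> convex hull ((\<lambda>v. axis v 1) ` \<sigma>)"
  shows "\<And>v. 0 \<le> (y::real^'v) $ v" "\<And>v. v \<notin> \<sigma> \<Longrightarrow> y $ v = 0" "(\<Sum>v\<in>UNIV. y $ v) = 1"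
proof -
  let ?S = "{y::real^'v. (\<forall>v. 0 \<le> y $ v) \<and> (\<forall>v. v \<notin> \<sigma> \<longrightarrow> y $ v = 0) \<and> (\<Sum>v\<in>UNIV. y $ v) = 1}"
  have "convex ?S"
    by (rule convexI) (auto simp: sum.distrib sum_distrib_left[symmetric])
  moreover have "(\<lambda>v. axis v 1) ` \<sigma> \<subseteq> ?S"
    by (auto simp: axis_def if_distrib cong: if_cong)
  ultimately have "convex hull ((\<lambda>v. axis v 1) ` \<sigma>) \<subseteq> ?S" by (simp add: hull_minimal)
  then show "\<And>v. 0 \<le> y $ v" "\<And>v. v \<notin> \<sigma> \<Longrightarrow> y $ v = 0" "(\<Sum>v\<in>UNIV. y $ v) = 1"
    using assms by auto
qed

lemma simplices_subsetD:
  assumes "simplicial_complex_on_type K" "\<sigma> \<in> K" "\<tau> \<subseteq> \<sigma>" "card \<tau> = Suc n"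
  shows "\<tau> \<in> simplices n K"
proof -
  have "\<tau> \<noteq> {}" using assms(4) by auto
  then show ?thesis using assms unfolding simplicial_complex_on_type_def simplices_def by auto
qed

text \<open>Near the midpoint of an edge without triangles the realization is a segment. A chart
  there would yield a continuous injection from a nonempty open subset of the plane into the
  line.\<close>

lemma edge_of_surface_in_triangle:
  fixes K :: "('v::finite) set set"
  assumes K: "simplicial_complex_on_type K" and surf: "surface (realization K)"
    and edge: "{i, j} \<in> simplices 1 K"
  obtains k where "{i, j, k} \<in> simplices 2 K"
proof (rule ccontr)
  assume neg: "\<not> thesis"
  have no: "{i, j, k} \<notin> simplices 2 K" for k using neg that by auto
  have ij: "i \<noteq> j" and ijK: "{i, j} \<in> K" using edge by (auto simp: simplices_def)
  \<comment> \<open>Intersected with the realization, this is the open star of the edge.\<close>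
  let ?O = "{y::real^'v. y $ i > 0 \<and> y $ j > 0}"
  have openO: "open ?O"
    by (intro open_Collect_conj open_Collect_less continuous_intros)
  have inedge: "(\<forall>v. v \<noteq> i \<and> v \<noteq> j \<longrightarrow> y $ v = 0) \<and> y $ i + y $ j = 1"
    if yR: "y \<in> realization K" and yO: "y \<in> ?O" for y
  proof -
    obtain \<sigma> where \<sigma>: "\<sigma> \<in> K" "y \<in> convex hull ((\<lambda>v. axis v 1) ` \<sigma>)"
      using yR by (auto simp: realization_def)
    note y = convex_hull_axesD[OF \<sigma>(2)]
    have sub: "{i, j} \<subseteq> \<sigma>" using y(2)[of i] y(2)[of j] yO by auto
    have "\<sigma> \<subseteq> {i, j}"
    proof
      fix k assume "k \<in> \<sigma>"
      show "k \<in> {i, j}"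
      proof (rule ccontr)
        assume "k \<notin> {i, j}"
        then have "card {i, j, k} = Suc 2" using ij by auto
        then show False using simplices_subsetD[OF K \<sigma>(1), of "{i, j, k}" 2] sub \<open>k \<in> \<sigma>\<close> no by auto
      qed
    qed
    then have z: "y $ v = 0" if "v \<noteq> i" "v \<noteq> j" for v using y(2) that by blast
    have "1 = (\<Sum>v\<in>UNIV. y $ v)" using y(3) by simp
    also have "\<dots> = (\<Sum>v\<in>{i, j}. y $ v)"
      by (rule sum.mono_neutral_right) (auto simp: z)
    finally show ?thesis using ij z by simp
  qed
  \<comment> \<open>By \<open>inedge\<close> a point of the star is determined by its coordinate at
    \<open>i\<close>.\<close>
  have inj: "inj_on (\<lambda>y::real^'v. y $ i) (realization K \<inter> ?O)"
  proof (rule inj_onI)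
    fix x y assume xy: "x \<in> realization K \<inter> ?O" "y \<in> realization K \<inter> ?O" and eq: "x $ i = y $ i"
    have sum1: "x $ i + x $ j = 1" "y $ i + y $ j = 1"
      and zero: "\<And>v. v \<noteq> i \<Longrightarrow> v \<noteq> j \<Longrightarrow> x $ v = 0 \<and> y $ v = 0"
      using inedge xy by blast+
    have "x $ j = y $ j" using sum1 eq by linarith
    then have "x $ v = y $ v" for v using zero eq by metis
    then show "x = y" by (simp add: vec_eq_iff)
  qed
  define m :: "real^'v" where "m = (1/2) *\<^sub>R axis i 1 + (1/2) *\<^sub>R axis j 1"
  have "m \<in> convex hull ((\<lambda>v. axis v 1) ` {i, j})"
    unfolding m_def by (rule convexD[OF convex_convex_hull]) (auto intro: hull_inc)
  then have mR: "m \<in> realization K" using ijK unfolding realization_def by blast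
  have mO: "m \<in> ?O" using ij by (simp add: m_def axis_def)
  obtain U and W :: "(real^2) set" where U: "openin (top_of_set (realization K)) U" "m \<in> U"
    and W: "open W" "U homeomorphic W"
    using surf mR unfolding surface_def by blast
  obtain f g where fg: "homeomorphism U W f g" using W(2) homeomorphic_def by blast
  have UR: "U \<subseteq> realization K" using U(1) openin_imp_subset by blast
  have "openin (top_of_set U) (U \<inter> ?O)" using openO by (simp add: openin_open_Int)
  then have "openin (top_of_set W) (f ` (U \<inter> ?O))"
    using homeomorphism_imp_open_map[OF fg] by blast
  then have op: "open (f ` (U \<inter> ?O))" using W(1) by (simp add: openin_open_eq)
  have gf: "g (f y) = y" if "y \<in> U" for y using fg that by (simp add: homeomorphism_def)
  have contg: "continuous_on (f ` (U \<inter> ?O)) g"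
  proof (rule continuous_on_subset)
    show "continuous_on W g" "f ` (U \<inter> ?O) \<subseteq> W" using fg by (auto simp: homeomorphism_def)
  qed
  have "DIM(real^2) \<le> DIM(real)"
  proof (rule invariance_of_dimension[of "f ` (U \<inter> ?O)" "\<lambda>w. g w $ i"])
    show "continuous_on (f ` (U \<inter> ?O)) (\<lambda>w. g w $ i)"
      by (intro continuous_intros contg)
    show "inj_on (\<lambda>w. g w $ i) (f ` (U \<inter> ?O))"
    proof (rule inj_onI)
      fix v w assume v: "v \<in> f ` (U \<inter> ?O)" and w: "w \<in> f ` (U \<inter> ?O)" and eq: "g v $ i = g w $ i"
      obtain a b where a: "v = f a" "a \<in> U \<inter> ?O" and b: "w = f b" "b \<in> U \<inter> ?O"
        using v w by blast
      have "a \<in> realization K \<inter> ?O" "b \<in> realization K \<inter> ?O" using a b UR by blast+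
      moreover have "a $ i = b $ i" using eq gf a b by simp
      ultimately have "a = b" using inj by (blast dest: inj_onD)
      then show "v = w" using a b by simp
    qed
  qed (use op U(2) mO in auto)
  then show False by simp
qed

text \<open>The piecewise linear extension \<open>F\<close> takes only values of \<open>x\<close>,
  and a continuous function with finite range on a connected set is constant.\<close>

lemma constant_if_edgewise_constant:
  fixes K :: "('v::finite) set set" and x :: "real^'v"
  assumes K: "simplicial_complex_on_type K" and conn: "connected (realization K)"
    and edges: "\<And>i j. {i, j} \<in> simplices 1 K \<Longrightarrow> x $ i = x $ j"
  shows "x $ u = x $ v"
proof -
  define F where "F y = (\<Sum>v\<in>UNIV. y $ v * x $ v)" for y :: "real^'v"
  have "F ` realization K \<subseteq> range (($) x)"
  proof
    fix z assume "z \<in> F ` realization K"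
    then obtain y \<sigma> where \<sigma>: "\<sigma> \<in> K" "y \<in> convex hull ((\<lambda>v. axis v 1) ` \<sigma>)" and z: "z = F y"
      by (auto simp: realization_def)
    note y = convex_hull_axesD[OF \<sigma>(2)]
    obtain s where s: "s \<in> \<sigma>" using K \<sigma>(1) by (metis simplicial_complex_on_type_def ex_in_conv)
    \<comment> \<open>Off the simplex the barycentric coordinate vanishes; on it, \<open>v\<close>
      and \<open>s\<close> are equal or span an edge.\<close>
    have "y $ v * x $ v = y $ v * x $ s" for v
    proof (cases "v \<in> \<sigma> \<and> v \<noteq> s")
      case True
      then have "{v, s} \<in> simplices 1 K"
        using simplices_subsetD[OF K \<sigma>(1), of "{v, s}" 1] s by simp
      then show ?thesis using edges by metis
    next
      case False
      then show ?thesis using y(2)[of v] by auto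
    qed
    then have "F y = (\<Sum>v\<in>UNIV. y $ v) * x $ s"
      unfolding F_def sum_distrib_right by (intro sum.cong) simp_all
    then have "F y = x $ s" by (simp add: y(3))
    then show "z \<in> range (($) x)" using z by auto
  qed
  then have "finite (F ` realization K)" by (rule finite_subset) simp
  moreover have "continuous_on (realization K) F"
    unfolding F_def by (intro continuous_intros)
  ultimately have const: "F constant_on realization K"
    using conn continuous_finite_range_constant by blast
  have "axis w 1 \<in> realization K" for w
    using K unfolding realization_def simplicial_complex_on_type_def
    by (intro UN_I[of "{w}"]) auto
  moreover have "F (axis w 1) = x $ w" for w
    unfolding F_def axis_def by (simp add: if_distrib[of "\<lambda>a. a * _"] cong: if_cong)
  ultimately show ?thesis using const unfolding constant_on_def by metis
qed

section \<open>Existence and uniqueness of the triangle center\<close>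

text \<open>The witness comes from Cramer's rule.\<close>

lemma cross2_solve_unique:
  assumes "cross2 a b \<noteq> 0"
  shows "\<exists>!v. v \<bullet> a = \<alpha> \<and> v \<bullet> b = \<beta>"
proof (rule ex1I)
  let ?v = "vector [(\<alpha> * b $ 2 - \<beta> * a $ 2) / cross2 a b, (\<beta> * a $ 1 - \<alpha> * b $ 1) / cross2 a b] :: real^2"
  have "?v \<bullet> a = (\<alpha> * cross2 a b) / cross2 a b" "?v \<bullet> b = (\<beta> * cross2 a b) / cross2 a b"
    unfolding inner2 vector_2 times_divide_eq_left add_divide_distrib[symmetric]
    by (simp_all add: cross2_def algebra_simps)
  then show "?v \<bullet> a = \<alpha> \<and> ?v \<bullet> b = \<beta>" using assms by simp
next
  fix v assume v: "v \<bullet> a = \<alpha> \<and> v \<bullet> b = \<beta>"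
  then have "v $ 1 * cross2 a b = \<alpha> * b $ 2 - \<beta> * a $ 2" "v $ 2 * cross2 a b = \<beta> * a $ 1 - \<alpha> * b $ 1"
    unfolding inner2 cross2_def by (auto simp: algebra_simps)
  then show "v = vector [(\<alpha> * b $ 2 - \<beta> * a $ 2) / cross2 a b, (\<beta> * a $ 1 - \<alpha> * b $ 1) / cross2 a b]"
    using assms by (simp add: vec_eq_iff forall_2 field_simps)
qed

text \<open>The perpendicular foot on an edge is determined by a difference of powers; such differences
  telescope around a triangle.\<close>

lemma foot_iff_power_difference:
  fixes a b c :: "'a::real_inner"
  assumes "dist a b = s + t"
  shows "(c - a) \<bullet> (b - a) = s * (s + t) \<longleftrightarrow> (dist c a)\<^sup>2 - (dist c b)\<^sup>2 = s\<^sup>2 - t\<^sup>2"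
proof -
  have "2 * ((c - a) \<bullet> (b - a)) = (dist c a)\<^sup>2 - (dist c b)\<^sup>2 + (dist a b)\<^sup>2"
    unfolding dist_norm power2_norm_eq_inner
    by (simp add: inner_diff_left inner_diff_right inner_commute)
  then show ?thesis unfolding assms by (auto simp: power2_eq_square algebra_simps)
qed

text \<open>Turns the perpendicularity that defines the triangle center into a prescribed inner
  product at the vertex \<open>p i\<close>.\<close>

lemma edge_center_inner:
  assumes "p i \<noteq> p j"
  shows "(c - edge_center d p i j) \<bullet> (p j - p i) = (c - p i) \<bullet> (p j - p i) - d i j * dist (p i) (p j)"
proof -
  have "(d i j / dist (p i) (p j)) * ((p j - p i) \<bullet> (p j - p i)) = d i j * dist (p i) (p j)"
    using assms by (simp add: dist_norm norm_minus_commute power2_norm_eq_inner[symmetric] power2_eq_square)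
  then show ?thesis unfolding edge_center_def
    by (simp add: inner_diff_left[of _ _ "p j - p i"] inner_add_left diff_diff_eq[symmetric]
        del: inner_diff_right)
qed

lemma euclidean_layout_layout:
  assumes "duality_triangulation K d" "t \<in> simplices 2 K"
  shows "euclidean_layout d t (layout d t)"
proof -
  have "\<exists>p. euclidean_layout d t p"
    using assms unfolding duality_triangulation_def by blast
  then show ?thesis unfolding layout_def by (rule someI_ex)
qed

text \<open>Two perpendiculars determine a point, and the condition on squares puts it on the third,
  so the definite description in \<open>triangle_center\<close> is justified.\<close>

lemma triangle_center_inner:
  assumes K: "duality_triangulation K d" and t: "t \<in> simplices 2 K"
    and p: "euclidean_layout d t p" and ab: "a \<in> t" "b \<in> t" "a \<noteq> b"
  shows "(triangle_center d p t - p a) \<bullet> (p b - p a) = d a b * edge_length d a b"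
proof -
  obtain i j k where ijk: "t = {i, j, k}" "i \<noteq> j" "j \<noteq> k" "i \<noteq> k"
    using t unfolding simplices_def by (auto simp: card_3_iff)
  have squares: "(d i j)\<^sup>2 + (d j k)\<^sup>2 + (d k i)\<^sup>2 = (d j i)\<^sup>2 + (d i k)\<^sup>2 + (d k j)\<^sup>2"
    using K t unfolding ijk duality_triangulation_def by blast
  have dist: "dist (p x) (p y) = d x y + d y x" if "x \<in> t" "y \<in> t" "x \<noteq> y" for x y
    using p that unfolding euclidean_layout_def edge_length_def by blast
  have "\<not> collinear {p i, p j, p k}" using p unfolding euclidean_layout_def ijk by simp
  then have D: "cross2 (p j - p i) (p k - p i) \<noteq> 0" by (simp add: collinear_iff_cross2)
  have neq: "p x \<noteq> p y" if "x \<in> t" "y \<in> t" "x \<noteq> y" for x y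
  proof -
    have "p i \<noteq> p j" "p i \<noteq> p k" "p j \<noteq> p k"
      using D by (auto simp: cross2_def)
    then show ?thesis using that unfolding ijk by auto
  qed
  define P where "P c \<longleftrightarrow> (\<forall>x\<in>t. \<forall>y\<in>t. x \<noteq> y \<longrightarrow>
      (c - p x) \<bullet> (p y - p x) = d x y * (d x y + d y x))" for c
  have "\<exists>!v. v \<bullet> (p j - p i) = d i j * (d i j + d j i) \<and> v \<bullet> (p k - p i) = d i k * (d i k + d k i)"
    by (rule cross2_solve_unique[OF D])
  then obtain v where v: "v \<bullet> (p j - p i) = d i j * (d i j + d j i)"
      "v \<bullet> (p k - p i) = d i k * (d i k + d k i)"
    and uniq: "\<And>w. w \<bullet> (p j - p i) = d i j * (d i j + d j i) \<Longrightarrow>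
      w \<bullet> (p k - p i) = d i k * (d i k + d k i) \<Longrightarrow> w = v" by metis
  define c where "c = p i + v"
  have "(dist c (p i))\<^sup>2 - (dist c (p j))\<^sup>2 = (d i j)\<^sup>2 - (d j i)\<^sup>2"
    using v(1) foot_iff_power_difference[OF dist[of i j], of c] ijk by (simp add: c_def)
  moreover have "(dist c (p i))\<^sup>2 - (dist c (p k))\<^sup>2 = (d i k)\<^sup>2 - (d k i)\<^sup>2"
    using v(2) foot_iff_power_difference[OF dist[of i k], of c] ijk by (simp add: c_def)
  \<comment> \<open>For the edge between \<open>j\<close> and \<open>k\<close>, subtract the two
    equations at \<open>i\<close> and use \<open>squares\<close>.\<close>
  ultimately have "(dist c (p x))\<^sup>2 - (dist c (p y))\<^sup>2 = (d x y)\<^sup>2 - (d y x)\<^sup>2"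
    if "x \<in> t" "y \<in> t" "x \<noteq> y" for x y
    using that squares unfolding ijk by auto
  then have Pc: "P c"
    unfolding P_def using foot_iff_power_difference[OF dist] by blast
  have "w = c" if "P w" for w
  proof -
    have "w - p i = v" using that ijk unfolding P_def by (intro uniq) auto
    then show ?thesis by (simp add: c_def algebra_simps)
  qed
  moreover have "triangle_center d p t = (THE c. P c)"
    unfolding triangle_center_def P_def
    by (intro arg_cong[where f = The] ext) (auto simp: edge_center_inner neq dist)
  ultimately have "P (triangle_center d p t)" using Pc by (metis theI)
  then show ?thesis using ab unfolding P_def edge_length_def by blast
qed

section \<open>Signed heights as cross products\<close>

lemma mem_affine_hull_2_iff_cross2:
  assumes "a \<noteq> b"
  shows "x \<in> affine hull {a, b} \<longleftrightarrow> cross2 (b - a) (x - a) = 0"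
  using assms collinear_3_affine_hull[of a b x] collinear_iff_cross2[of a b x]
  by (simp add: insert_commute)

text \<open>The cross product is affine along the segment, so it avoids zero exactly when its end
  values have the same strict sign.\<close>

lemma closed_segment_crosses_line_iff:
  fixes a b c q :: "real^2"
  assumes "a \<noteq> b"
  shows "closed_segment c q \<inter> affine hull {a, b} = {} \<longleftrightarrow>
    cross2 (b - a) (c - a) * cross2 (b - a) (q - a) > 0"
proof -
  let ?f = "\<lambda>x. cross2 (b - a) (x - a)"
  have aff: "?f ((1 - u) *\<^sub>R c + u *\<^sub>R q) = (1 - u) * ?f c + u * ?f q" for u
    by (simp add: cross2_def algebra_simps)
  have "closed_segment c q \<inter> affine hull {a, b} \<noteq> {} \<longleftrightarrow>
      (\<exists>u. 0 \<le> u \<and> u \<le> 1 \<and> (1 - u) * ?f c + u * ?f q = 0)"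
    unfolding closed_segment_def using mem_affine_hull_2_iff_cross2[OF assms] aff by auto
  also have "\<dots> \<longleftrightarrow> \<not> ?f c * ?f q > 0"
  proof
    assume "\<exists>u. 0 \<le> u \<and> u \<le> 1 \<and> (1 - u) * ?f c + u * ?f q = 0"
    then obtain u where u: "0 \<le> u" "u \<le> 1" "(1 - u) * ?f c = - u * ?f q" by (auto simp: algebra_simps)
    show "\<not> ?f c * ?f q > 0"
    proof
      assume pos: "?f c * ?f q > 0"
      have "(1 - u) * (?f c * ?f q) + u * (?f q)\<^sup>2 = 0"
        using u(3) by (simp add: power2_eq_square mult.assoc[symmetric])
      moreover have "(1 - u) * (?f c * ?f q) \<ge> 0" "u * (?f q)\<^sup>2 \<ge> 0" using u pos by auto
      ultimately have "(1 - u) * (?f c * ?f q) = 0" "u * (?f q)\<^sup>2 = 0" by linarith+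
      then show False using pos by auto
    qed
  next
    assume le: "\<not> ?f c * ?f q > 0"
    show "\<exists>u. 0 \<le> u \<and> u \<le> 1 \<and> (1 - u) * ?f c + u * ?f q = 0"
    proof (cases "?f c = ?f q")
      case True
      then have "?f c = 0" using le by (metis not_real_square_gt_zero)
      then show ?thesis by (intro exI[of _ 0]) simp
    next
      case False
      \<comment> \<open>The zero of the affine function with end values \<open>?f c\<close> and
        \<open>?f q\<close>.\<close>
      define u where "u = ?f c / (?f c - ?f q)"
      have "0 \<le> u \<and> u \<le> 1"
        using le False unfolding u_def
        by (auto simp: zero_le_divide_iff divide_le_eq_1 not_less mult_le_0_iff)
      moreover have "(1 - u) * ?f c + u * ?f q = 0"
        using False unfolding u_def by (simp add: field_simps)
      ultimately show ?thesis by blast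
    qed
  qed
  finally show ?thesis by blast
qed

text \<open>The vector from edge center to triangle center is perpendicular to the edge, so its
  length is the cross product with the edge, up to sign, divided by the edge length. The sign of the
  triangle's area accounts for the side.\<close>

lemma height_eq_cross2:
  assumes K: "duality_triangulation K d" and t: "{i, j, k} \<in> simplices 2 K"
  defines "p \<equiv> layout d {i, j, k}"
  defines "c \<equiv> triangle_center d p {i, j, k}"
  shows "height d i j k =
    sgn (cross2 (p j - p i) (p k - p i)) * cross2 (p j - p i) (c - p i) / edge_length d i j"
proof -
  let ?e = "p j - p i" and ?m = "edge_center d p i j"
  have lay: "euclidean_layout d {i, j, k} p"
    unfolding p_def by (rule euclidean_layout_layout[OF K t])
  have ij: "i \<noteq> j" using t by (auto simp: simplices_def card_insert_if split: if_splits)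
  have dist: "dist (p i) (p j) = edge_length d i j"
    using lay ij unfolding euclidean_layout_def by blast
  have "\<not> collinear {p i, p j, p k}" using lay unfolding euclidean_layout_def by simp
  then have D: "cross2 ?e (p k - p i) \<noteq> 0" by (simp add: collinear_iff_cross2)
  then have neq: "p i \<noteq> p j" by (auto simp: cross2_def)
  then have l: "edge_length d i j > 0" using dist by (metis zero_less_dist_iff)
  have "(c - p i) \<bullet> ?e = d i j * edge_length d i j"
    unfolding c_def using triangle_center_inner[OF K t lay] ij by blast
  then have "(c - ?m) \<bullet> ?e = 0"
    using edge_center_inner[where p = p and i = i and j = j and c = c and d = d, OF neq] dist by simp
  then have "(cross2 ?e (c - ?m))\<^sup>2 = (norm ?e * dist c ?m)\<^sup>2"
    using cross2_inner_lagrange[of ?e "c - ?m"]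
    by (simp add: inner_commute dist_norm power_mult_distrib)
  \<comment> \<open>The base point may slide along the edge.\<close>
  moreover have "cross2 ?e (c - ?m) = cross2 ?e (c - p i)"
  proof -
    have "cross2 e (c - (a + s *\<^sub>R e)) = cross2 e (c - a)" for e a s
      unfolding cross2_def by (simp add: algebra_simps)
    then show ?thesis unfolding edge_center_def by blast
  qed
  moreover have "norm ?e = edge_length d i j"
    using dist by (simp add: dist_norm norm_minus_commute)
  ultimately have "(cross2 ?e (c - p i))\<^sup>2 = (edge_length d i j * dist c ?m)\<^sup>2"
    by simp
  then have "\<bar>cross2 ?e (c - p i)\<bar> = \<bar>edge_length d i j * dist c ?m\<bar>"
    by (simp only: power2_eq_iff abs_eq_iff)
  then have abs: "dist c ?m = \<bar>cross2 ?e (c - p i)\<bar> / edge_length d i j"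
    using l by (simp add: abs_mult field_simps)
  have "height d i j k = (if cross2 ?e (c - p i) * cross2 ?e (p k - p i) > 0
      then dist c ?m else - dist c ?m)"
    unfolding height_def Let_def p_def[symmetric] c_def[symmetric]
      closed_segment_crosses_line_iff[OF neq] by (rule refl)
  \<comment> \<open>If the center lies on the line, both sides are 0.\<close>
  also have "\<dots> = sgn (cross2 ?e (p k - p i)) * cross2 ?e (c - p i) / edge_length d i j"
    using D unfolding abs by (auto simp: sgn_if zero_less_mult_iff)
  finally show ?thesis .
qed

text \<open>Positivity of \<open>d\<close> in both directions of each edge supplies the six inner
  product hypotheses of the planar lemma.\<close>

lemma triangle_form_definite:
  assumes K: "duality_triangulation K d" and t: "{i, j, k} \<in> simplices 2 K"
    and pos: "\<And>i j. (i, j) \<in> directed_edges K \<Longrightarrow> d i j > 0"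
  defines "Q \<equiv> \<lambda>x y z. height d i j k / edge_length d i j * (x - y)\<^sup>2
    + height d j k i / edge_length d j k * (y - z)\<^sup>2
    + height d k i j / edge_length d k i * (z - x)\<^sup>2"
  shows "Q x y z \<ge> 0" and "Q x y z = 0 \<Longrightarrow> x = y \<and> y = z"
proof -
  define t where "t = {i, j, k}"
  define p where "p = layout d t"
  define c where "c = triangle_center d p t"
  \<comment> \<open>Layout and center depend only on the vertex set, so all three heights refer to
    the same ones.\<close>
  have jki: "{j, k, i} = t" and kij: "{k, i, j} = t" and ijk: "{i, j, k} = t"
    by (auto simp: t_def)
  have tK: "t \<in> simplices 2 K" using t by (simp add: t_def)
  have card: "card {i, j, k} = 3" using t by (simp add: simplices_def)
  have neq: "i \<noteq> j" "j \<noteq> k" "i \<noteq> k" using card by (auto simp: card_insert_if split: if_splits)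
  have lay: "euclidean_layout d t p"
    unfolding p_def by (rule euclidean_layout_layout[OF K tK])
  have foot: "(c - p a) \<bullet> (p b - p a) > 0" if "a \<in> t" "b \<in> t" "a \<noteq> b" for a b
  proof -
    have sc: "simplicial_complex_on_type K" using K by (simp add: duality_triangulation_def)
    have "{a, b} \<in> simplices 1 K"
      using simplices_subsetD[OF sc, of t "{a, b}" 1] tK that by (auto simp: simplices_def)
    then have "d a b > 0" "d b a > 0"
      using pos by (auto simp: directed_edges_def insert_commute)
    then show ?thesis
      using triangle_center_inner[OF K tK lay that] by (simp add: c_def edge_length_def)
  qed
  define D where "D = cross2 (p j - p i) (p k - p i)"
  have "\<not> collinear {p i, p j, p k}" using lay unfolding euclidean_layout_def t_def by simp
  then have D: "D \<noteq> 0" by (simp add: collinear_iff_cross2 D_def)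
  have cyc: "cross2 (p k - p j) (p i - p j) = D" "cross2 (p i - p k) (p j - p k) = D"
    unfolding D_def cross2_def by (simp_all add: algebra_simps)
  have dist: "dist (p a) (p b) = edge_length d a b" if "a \<in> t" "b \<in> t" "a \<noteq> b" for a b
    using lay that unfolding euclidean_layout_def by blast
  have h: "height d i j k / edge_length d i j = sgn D * cross2 (p j - p i) (c - p i) / (dist (p i) (p j))\<^sup>2"
    "height d j k i / edge_length d j k = sgn D * cross2 (p k - p j) (c - p j) / (dist (p j) (p k))\<^sup>2"
    "height d k i j / edge_length d k i = sgn D * cross2 (p i - p k) (c - p k) / (dist (p k) (p i))\<^sup>2"
    using height_eq_cross2[OF K, of i j k] height_eq_cross2[OF K, of j k i]
      height_eq_cross2[OF K, of k i j] tK neq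
    unfolding jki kij ijk p_def[symmetric] c_def[symmetric] cyc D_def[symmetric]
    by (simp_all add: dist t_def power2_eq_square)
  note * = weighted_triangle_form_definite[OF D[unfolded D_def] foot foot foot foot foot foot,
      folded D_def, where x = x and y = y and z = z]
  show "Q x y z \<ge> 0" unfolding Q_def h by (rule *(1)) (use neq in \<open>auto simp: t_def\<close>)
  show "Q x y z = 0 \<Longrightarrow> x = y \<and> y = z"
    unfolding Q_def h by (rule *(2)) (use neq in \<open>auto simp: t_def\<close>)
qed

text \<open>Exchanging \<open>i\<close> and \<open>j\<close> negates both cross products and keeps
  the layout.\<close>

lemma height_commute:
  assumes K: "duality_triangulation K d" and t: "{i, j, k} \<in> simplices 2 K"
  shows "height d j i k = height d i j k"
proof -
  have eq: "{j, i, k} = {i, j, k}" by auto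
  define p where "p = layout d {i, j, k}"
  have "cross2 (p i - p j) (y - p j) = - cross2 (p j - p i) (y - p i)" for y
    unfolding cross2_def by (simp add: algebra_simps)
  moreover have "edge_length d j i = edge_length d i j" by (simp add: edge_length_def)
  ultimately show ?thesis
    using height_eq_cross2[OF K t] height_eq_cross2[OF K, of j i k] t
    unfolding eq p_def[symmetric] by (simp add: sgn_minus)
qed

section \<open>The Laplacian as a sum over triangles\<close>

text \<open>The default 0 also covers triples with repeated vertices, so sums may run over all
  triples.\<close>

definition triangle_weight :: "'v set set \<Rightarrow> ('v \<Rightarrow> 'v \<Rightarrow> real) \<Rightarrow> 'v \<Rightarrow> 'v \<Rightarrow> 'v \<Rightarrow> real" where
  "triangle_weight K d i j k =
    (if {i, j, k} \<in> simplices 2 K then height d i j k / edge_length d i j else 0)"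

definition edge_weight :: "('v::finite) set set \<Rightarrow> ('v \<Rightarrow> 'v \<Rightarrow> real) \<Rightarrow> 'v \<Rightarrow> 'v \<Rightarrow> real" where
  "edge_weight K d i j = (\<Sum>k\<in>UNIV. triangle_weight K d i j k)"

lemma edge_weight_commute:
  assumes "duality_triangulation K d"
  shows "edge_weight K d i j = edge_weight K d j i"
  unfolding edge_weight_def triangle_weight_def
  using height_commute[OF assms]
  by (intro sum.cong) (auto simp: insert_commute edge_length_def add.commute)

lemma edge_weight_eq_dual_length:
  "edge_weight K d i j = dual_length K d i j / edge_length d i j"
  unfolding edge_weight_def triangle_weight_def dual_length_def sum_divide_distrib
  by (simp add: sum.inter_filter[symmetric])

lemma edge_weight_eq_0:
  assumes "simplicial_complex_on_type K" "{i, j} \<notin> simplices 1 K"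
  shows "edge_weight K d i j = 0"
proof -
  have "{i, j, k} \<notin> simplices 2 K" for k
  proof
    assume t: "{i, j, k} \<in> simplices 2 K"
    then have "card {i, j} = Suc 1"
      by (auto simp: simplices_def card_insert_if split: if_splits)
    then show False
      using simplices_subsetD[OF assms(1), of "{i, j, k}" "{i, j}" 1] t assms(2)
      by (auto simp: simplices_def)
  qed
  then show ?thesis by (simp add: edge_weight_def triangle_weight_def)
qed

text \<open>The weight matrix minus the diagonal of its row sums; this is correct on the diagonal
  because \<open>{i, i}\<close> is not an edge, so its weight is 0.\<close>

lemma laplacian_component:
  assumes "simplicial_complex_on_type K"
  shows "laplacian K d $ i $ j
    = edge_weight K d i j - (if i = j then \<Sum>k\<in>UNIV. edge_weight K d i k else 0)"
proof -
  have "(\<Sum>k | {i, k} \<in> simplices 1 K. dual_length K d i k / edge_length d i k)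
      = (\<Sum>k\<in>UNIV. edge_weight K d i k)"
    unfolding edge_weight_eq_dual_length[symmetric]
    by (rule sum.mono_neutral_left) (auto intro: edge_weight_eq_0[OF assms])
  moreover have "{i, i} \<notin> simplices 1 K" by (simp add: simplices_def)
  ultimately show ?thesis
    using edge_weight_eq_0[OF assms, of i j d]
    by (auto simp: laplacian_def edge_weight_eq_dual_length[symmetric] edge_weight_eq_0[OF assms])
qed

lemma laplacian_mult_component:
  assumes "simplicial_complex_on_type K"
  shows "(laplacian K d *v x) $ i = (\<Sum>j\<in>UNIV. edge_weight K d i j * (x $ j - x $ i))"
proof -
  have "(laplacian K d *v x) $ i = (\<Sum>j\<in>UNIV. edge_weight K d i j * x $ j
      - (if i = j then (\<Sum>k\<in>UNIV. edge_weight K d i k) * x $ j else 0))"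
    unfolding matrix_vector_mult_def
    by (simp add: laplacian_component[OF assms] left_diff_distrib if_distrib[of "\<lambda>a. a * _"] cong: if_cong)
  then show ?thesis
    by (simp add: sum_subtractf right_diff_distrib sum_distrib_right)
qed

text \<open>The factor 6 has two sources: symmetrizing in the two ends of an edge gives 2, and
  averaging over the three rotations of a triple gives 3.\<close>

lemma inner_laplacian_mult:
  assumes K: "duality_triangulation K d"
  shows "6 * (x \<bullet> (laplacian K d *v x)) = - (\<Sum>i\<in>UNIV. \<Sum>j\<in>UNIV. \<Sum>k\<in>UNIV.
      triangle_weight K d i j k * (x $ i - x $ j)\<^sup>2
    + triangle_weight K d j k i * (x $ j - x $ k)\<^sup>2
    + triangle_weight K d k i j * (x $ k - x $ i)\<^sup>2)"
proof -
  have sc: "simplicial_complex_on_type K" using K by (simp add: duality_triangulation_def)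
  let ?w = "edge_weight K d"
  define S where "S = (\<Sum>i\<in>UNIV. \<Sum>j\<in>UNIV. ?w i j * (x $ i - x $ j)\<^sup>2)"
  have 1: "x \<bullet> (laplacian K d *v x) = (\<Sum>i\<in>UNIV. \<Sum>j\<in>UNIV. ?w i j * (x $ j - x $ i) * x $ i)"
    unfolding inner_vec_def laplacian_mult_component[OF sc]
    by (simp add: sum_distrib_left mult_ac)
  \<comment> \<open>Exchange of the summation variables, by symmetry of the weights. Adding both
    expressions for the form produces the squares in \<open>S\<close>.\<close>
  also have "\<dots> = (\<Sum>i\<in>UNIV. \<Sum>j\<in>UNIV. ?w i j * (x $ i - x $ j) * x $ j)"
    by (subst sum.swap) (simp add: edge_weight_commute[OF K])
  finally have 2: "x \<bullet> (laplacian K d *v x)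
      = (\<Sum>i\<in>UNIV. \<Sum>j\<in>UNIV. ?w i j * (x $ i - x $ j) * x $ j)" .
  have "x \<bullet> (laplacian K d *v x) + x \<bullet> (laplacian K d *v x) = - S"
    unfolding S_def
    by (subst 1, subst 2, simp only: sum.distrib[symmetric] sum_negf[symmetric])
      (intro sum.cong refl, simp add: algebra_simps power2_eq_square)
  moreover define G where "G i j k = triangle_weight K d i j k * (x $ i - x $ j)\<^sup>2" for i j k
  have S: "S = (\<Sum>i\<in>UNIV. \<Sum>j\<in>UNIV. \<Sum>k\<in>UNIV. G i j k)"
    unfolding S_def edge_weight_def G_def by (simp add: sum_distrib_right)
  have rot: "(\<Sum>i\<in>UNIV. \<Sum>j\<in>UNIV. \<Sum>k\<in>UNIV. g j k i) = (\<Sum>i\<in>UNIV. \<Sum>j\<in>UNIV. \<Sum>k\<in>UNIV. g i j k)"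
    for g :: "'a \<Rightarrow> 'a \<Rightarrow> 'a \<Rightarrow> real"
  proof -
    have "(\<Sum>i\<in>UNIV. \<Sum>j\<in>UNIV. \<Sum>k\<in>UNIV. g j k i) = (\<Sum>j\<in>UNIV. \<Sum>i\<in>UNIV. \<Sum>k\<in>UNIV. g j k i)"
      by (rule sum.swap)
    also have "\<dots> = (\<Sum>j\<in>UNIV. \<Sum>k\<in>UNIV. \<Sum>i\<in>UNIV. g j k i)"
      by (intro sum.cong refl sum.swap)
    finally show ?thesis .
  qed
  have "3 * S = (\<Sum>i\<in>UNIV. \<Sum>j\<in>UNIV. \<Sum>k\<in>UNIV. G i j k + G j k i + G k i j)"
    using S rot[of G] rot[of "\<lambda>i j k. G j k i"] by (simp add: sum.distrib)
  ultimately show ?thesis unfolding G_def by simp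
qed

section \<open>Semidefiniteness and the nullspace\<close>

theorem theorem36:
  fixes K :: "('v::finite) set set" and d :: "'v \<Rightarrow> 'v \<Rightarrow> real"
  assumes "duality_triangulation K d"
    and "connected (realization K)"
    and "\<And>i j. (i, j) \<in> directed_edges K \<Longrightarrow> d i j > 0"
  shows "negative_semidefinite (laplacian K d) \<and>
    {x. laplacian K d *v x = 0} = span (range (\<lambda>c::real. \<chi> i. c))"
proof
  have sc: "simplicial_complex_on_type K" and surf: "surface (realization K)"
    using assms(1) by (auto simp: duality_triangulation_def)
  define q where "q x i j k = triangle_weight K d i j k * (x $ i - x $ j)\<^sup>2
    + triangle_weight K d j k i * (x $ j - x $ k)\<^sup>2
    + triangle_weight K d k i j * (x $ k - x $ i)\<^sup>2" for x :: "real^'v" and i j k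
  have q_eq: "q x i j k = (if {i, j, k} \<in> simplices 2 K
      then height d i j k / edge_length d i j * (x $ i - x $ j)\<^sup>2
        + height d j k i / edge_length d j k * (x $ j - x $ k)\<^sup>2
        + height d k i j / edge_length d k i * (x $ k - x $ i)\<^sup>2
      else 0)" for x i j k
  proof -
    have "{j, k, i} = {i, j, k}" "{k, i, j} = {i, j, k}" by auto
    then show ?thesis unfolding q_def triangle_weight_def by (simp only: if_split) simp
  qed
  have q_nonneg: "q x i j k \<ge> 0" for x i j k
  proof (cases "{i, j, k} \<in> simplices 2 K")
    case True
    show ?thesis
      using triangle_form_definite(1)[OF assms(1) True assms(3)] by (simp only: q_eq True if_True)
  qed (simp add: q_eq)
  have q_zero: "x $ i = x $ j" if "{i, j, k} \<in> simplices 2 K" "q x i j k = 0" for x i j k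
    using triangle_form_definite(2)[OF assms(1) that(1) assms(3)] that(2)
    unfolding q_eq if_P[OF that(1)] by blast
  have form: "6 * (x \<bullet> (laplacian K d *v x)) = - (\<Sum>i\<in>UNIV. \<Sum>j\<in>UNIV. \<Sum>k\<in>UNIV. q x i j k)" for x
    unfolding q_def by (rule inner_laplacian_mult[OF assms(1)])
  have "x \<bullet> (laplacian K d *v x) \<le> 0" for x
  proof -
    have "(\<Sum>i\<in>UNIV. \<Sum>j\<in>UNIV. \<Sum>k\<in>UNIV. q x i j k) \<ge> 0" by (intro sum_nonneg q_nonneg)
    with form[of x] show ?thesis by linarith
  qed
  moreover have "transpose (laplacian K d) = laplacian K d"
    unfolding vec_eq_iff transpose_def
    by (auto simp: laplacian_component[OF sc] edge_weight_commute[OF assms(1)])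
  ultimately show "negative_semidefinite (laplacian K d)"
    by (simp add: negative_semidefinite_def)
  show "{x. laplacian K d *v x = 0} = span (range (\<lambda>c::real. \<chi> i. c))"
  proof
    show "{x. laplacian K d *v x = 0} \<subseteq> span (range (\<lambda>c::real. \<chi> i. c))"
    proof
      fix x assume "x \<in> {x. laplacian K d *v x = 0}"
      \<comment> \<open>On a kernel vector the form vanishes; its summands are nonnegative, so each
        is 0.\<close>
      then have "(\<Sum>i\<in>UNIV. \<Sum>j\<in>UNIV. \<Sum>k\<in>UNIV. q x i j k) = 0" using form[of x] by simp
      then have q0: "q x i j k = 0" for i j k
        by (simp add: sum_nonneg_eq_0_iff sum_nonneg q_nonneg)
      have "x $ i = x $ j" if "{i, j} \<in> simplices 1 K" for i j
        using edge_of_surface_in_triangle[OF sc surf that] q_zero[OF _ q0] by blast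
      then have "x $ u = x $ v" for u v
        by (rule constant_if_edgewise_constant[OF sc assms(2)])
      then have "x = (\<chi> i. x $ undefined)" by (simp add: vec_eq_iff)
      then show "x \<in> span (range (\<lambda>c::real. \<chi> i. c))" by (metis rangeI span_base)
    qed
    \<comment> \<open>Every term of a row contains a difference of two values, which is 0 for
      constants.\<close>
    have "range (\<lambda>c::real. \<chi> i. c) \<subseteq> {x. laplacian K d *v x = 0}"
      by (auto simp: vec_eq_iff laplacian_mult_component[OF sc])
    moreover have "subspace {x. laplacian K d *v x = 0}"
      by (auto simp: subspace_def matrix_vector_right_distrib matrix_vector_mult_scaleR)
    ultimately show "span (range (\<lambda>c::real. \<chi> i. c)) \<subseteq> {x. laplacian K d *v x = 0}"
      by (rule span_minimal)
  qed
qed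

end
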